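(* Let $\mathcal H$ be a real Hilbert space, $C\subseteq\mathcal H$ nonempty, closed and convex, and $F:\mathcal H\to\mathcal H$. Assume that $SOL(C,F)\neq\emptyset$, that $F$ is monotone on $\mathcal H$ ($\langle F(x)-F(y),x-y\rangle\ge 0$ for all $x,y\in\mathcal H$), and that $F$ is Lipschitz continuous on $\mathcal H$ with some constant $L>0$. Assume that the sequence $\{\alpha_k\}_{k=0}^\infty\subset[0,1]$ satisfies $$\sum_{k=0}^\infty\alpha_k\|x^k-x^{k-1}\|<+\infty.$$ Then any sequence $\{x^k\}_{k=0}^\infty$ generated by the inertial PC-algorithm I (iPC I-2) described in the context converges weakly to a point of $SOL(C,F)$, i.e. to a solution of the variational inequality problem.
   Context: The variational inequality problem is: find $x^*\in C$ with $\langle F(x^* ),x-x^*\rangle\ge 0$ for all $x\in C$; its solution set is $SOL(C,F)$. $P_C$ denotes the metric projection onto $C$. Inertial PC-algorithm I (iPC I-2): fix $\nu\in(0,1)$, $\gamma\in(0,2)$ and starting points $x^{-1},x^0\in\mathcal H$. Given $x^{k-1},x^k$, set $$w^k=x^k+\alpha_k(x^k-x^{k-1}),\qquad y^k=P_C(w^k-\beta_kF(w^k)),$$ where $\beta_k>0$ is selected to satisfy $\beta_k\|F(w^k)-F(y^k)\|\le\nu\|w^k-y^k\|$. Define $$d(w^k,y^k)=(w^k-y^k)-\beta_k(F(w^k)-F(y^k)),\qquad \rho_k=\frac{\langle w^k-y^k,d(w^k,y^k)\rangle}{\|d(w^k,y^k)\|^2},$$ $$x^{k+1}=w^k-\gamma\rho_kd(w^k,y^k).$$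 It is understood that $d(w^k,y^k)\ne0$ for all $k$, so that $\rho_k$ is defined.
   Formalization: The step sizes are additionally assumed bounded away from zero (inf β_k > 0); without this the claim fails, e.g. C = H = R, F = id, ν = 1/2, γ = 1, α_k = 0, β_k = 1/(k+2)^2, x^0 = 2, where x^k tends to 1 but the only solution is 0. *)

theory Defs
  imports "HOL-Analysis.Analysis"
begin

(* The library's closest_point is restricted to the class heine_borel, hence to finite dimension.
   In a Hilbert space the minimiser below exists and is unique when C is nonempty, closed
   and convex. *)
definition metric_projection :: "'a::{real_inner,complete_space} set \<Rightarrow> 'a \<Rightarrow> 'a" where
  "metric_projection C x = (THE p. p \<in> C \<and> (\<forall>z\<in>C. dist x p \<le> dist x z))"

definition SOL :: "'a::real_inner set \<Rightarrow> ('a \<Rightarrow> 'a) \<Rightarrow> 'a set" where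
  "SOL C F = {s \<in> C. \<forall>x\<in>C. F s \<bullet> (x - s) \<ge> 0}"

definition monotone_operator :: "('a::real_inner \<Rightarrow> 'a) \<Rightarrow> bool" where
  "monotone_operator F \<longleftrightarrow> (\<forall>x y. (F x - F y) \<bullet> (x - y) \<ge> 0)"

definition weakly_converges_to :: "(nat \<Rightarrow> 'a::real_normed_vector) \<Rightarrow> 'a \<Rightarrow> bool" where
  "weakly_converges_to X l \<longleftrightarrow>
    (\<forall>f :: 'a \<Rightarrow> real. bounded_linear f \<longrightarrow> (\<lambda>k. f (X k)) \<longlonglongrightarrow> f l)"

definition pc_direction :: "('a::real_inner \<Rightarrow> 'a) \<Rightarrow> real \<Rightarrow> 'a \<Rightarrow> 'a \<Rightarrow> 'a" where
  "pc_direction F b w y = (w - y) - b *\<^sub>R (F w - F y)"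

definition pc_rho :: "('a::real_inner \<Rightarrow> 'a) \<Rightarrow> real \<Rightarrow> 'a \<Rightarrow> 'a \<Rightarrow> real" where
  "pc_rho F b w y = ((w - y) \<bullet> pc_direction F b w y) / (norm (pc_direction F b w y))\<^sup>2"

(* The iterates are indexed by int because they start at -1; values of x below -1 play no role.
   The step-size conditions here leave beta free to tend to 0, and then the iterates can stall:
   for F = id and C = UNIV on the real line, nu = 1/2, gamma = 1, alpha = 0 and
   beta k = 1 / (k + 2)^2, they are x k = (k + 2) / (k + 1), with limit 1, while SOL C F = {0}.
   Convergence results therefore need a positive lower bound on beta as well. Backtracking rules
   provide one for Lipschitz F. *)
definition generated_by_iPC_I2 ::
  "'a::{real_inner,complete_space} set \<Rightarrow> ('a \<Rightarrow> 'a) \<Rightarrow> real \<Rightarrow> real \<Rightarrow> (nat \<Rightarrow> real) \<Rightarrow> (nat \<Rightarrow> real)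
    \<Rightarrow> (int \<Rightarrow> 'a) \<Rightarrow> (nat \<Rightarrow> 'a) \<Rightarrow> (nat \<Rightarrow> 'a) \<Rightarrow> bool" where
  "generated_by_iPC_I2 C F \<nu> \<gamma> \<alpha> \<beta> x w y \<longleftrightarrow>
    (\<forall>k. w k = x (int k) + \<alpha> k *\<^sub>R (x (int k) - x (int k - 1)) \<and>
         y k = metric_projection C (w k - \<beta> k *\<^sub>R F (w k)) \<and>
         \<beta> k > 0 \<and>
         \<beta> k * norm (F (w k) - F (y k)) \<le> \<nu> * norm (w k - y k) \<and>
         pc_direction F (\<beta> k) (w k) (y k) \<noteq> 0 \<and>
         x (int k + 1) =
           w k - (\<gamma> * pc_rho F (\<beta> k) (w k) (y k)) *\<^sub>R pc_direction F (\<beta> k) (w k) (y k))"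

end

theory Submission
  imports Defs
begin

text \<open>
  The proof combines a quasi-Fejer estimate with an Opial argument.

  For a solution \<open>s\<close>, monotonicity and the obtuse-angle property of the projection show that the
  hyperplane through \<open>y\<close> orthogonal to the direction \<open>d\<close> separates \<open>w\<close> from \<open>s\<close>, and \<open>w - \<rho> d\<close> is
  the projection of \<open>w\<close> onto that hyperplane. The relaxed step therefore decreases the squared
  distance to \<open>s\<close> by at least a fixed multiple of \<open>\<parallel>w - y\<parallel>\<^sup>2\<close> (\<open>pc_step_decrease\<close>). The extrapolation
  from \<open>x\<close> to \<open>w\<close> costs only a summable amount, so \<open>\<parallel>x\<^sub>k - s\<parallel>\<close> converges for every solution \<open>s\<close>,
  and \<open>w\<^sub>k - y\<^sub>k\<close> tends to \<open>0\<close>.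

  The customary next step extracts weakly convergent subsequences. Here the set of weak cluster
  points is replaced by the tail hull, the intersection of the closed convex hulls of all tails.
  For a bounded sequence it is nonempty by the parallelogram law and completeness alone. An
  asymptotic upper bound on a continuous linear functional along the sequence passes to the whole
  tail hull. Monotonicity of \<open>F\<close> lets the variational inequality be tested at a fixed point,
  \<open>\<langle>F u, u - y\<^sub>k\<rangle> \<ge> - o(1)\<close>, where the unknown enters linearly; the step sizes are bounded away
  from \<open>0\<close> so that the error, of order \<open>(1 / \<beta>\<^sub>k + L) \<parallel>w\<^sub>k - y\<^sub>k\<parallel>\<close>, does vanish. Hence every point of
  the tail hull satisfies the limiting inequality and, by Minty's argument, is a solution. Opial's
  argument works with tail hulls as well (\<open>opial_tail_hull\<close>) and yields weak convergence.
\<close>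

section \<open>Nested convex sets and projections in Hilbert space\<close>

text \<open>The midpoint of \<open>p\<close> and \<open>q\<close> lies in \<open>K\<close>, so its distance from \<open>a\<close> is at least
  \<open>infdist a K\<close>; the parallelogram law turns this into a bound on \<open>dist p q\<close>.\<close>

lemma convex_shell_diameter:
  fixes K :: "'a::real_inner set"
  assumes "convex K" "p \<in> K" "q \<in> K" "dist a p \<le> r" "dist a q \<le> r"
  shows "(dist p q)\<^sup>2 \<le> 4 * (r\<^sup>2 - (infdist a K)\<^sup>2)"
proof -
  define mid where "mid = (1/2) *\<^sub>R p + (1/2) *\<^sub>R q"
  have "mid \<in> K"
    unfolding mid_def using assms(1-3) by (intro convexD) auto
  then have "infdist a K \<le> dist a mid"
    by (rule infdist_le)
  then have le: "(infdist a K)\<^sup>2 \<le> (dist a mid)\<^sup>2"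
    by (simp add: infdist_nonneg power_mono)
  have par: "(dist p q)\<^sup>2 = 2 * (dist a p)\<^sup>2 + 2 * (dist a q)\<^sup>2 - 4 * (dist a mid)\<^sup>2"
  proof -
    define u v where "u = a - p" and "v = a - q"
    have "p - q = v - u" "a - mid = (1/2) *\<^sub>R (u + v)"
      unfolding mid_def u_def v_def by (simp_all add: algebra_simps flip: scaleR_add_left)
    moreover have "(norm (v - u))\<^sup>2
        = 2 * (norm u)\<^sup>2 + 2 * (norm v)\<^sup>2 - 4 * (norm ((1/2) *\<^sub>R (u + v)))\<^sup>2"
      unfolding power2_norm_eq_inner
      by (simp add: inner_diff_left inner_diff_right inner_add_left inner_add_right
          inner_commute field_simps)
    ultimately show ?thesis
      unfolding dist_norm u_def[symmetric] v_def[symmetric] by simp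
  qed
  have "(dist a p)\<^sup>2 \<le> r\<^sup>2" "(dist a q)\<^sup>2 \<le> r\<^sup>2"
    using assms(4,5) by (auto intro: power_mono)
  then show ?thesis
    unfolding par using le by (simp add: right_diff_distrib)
qed

lemma infdist_less_imp_ex:
  assumes "A \<noteq> {}" "infdist a A < r"
  shows "\<exists>z\<in>A. dist a z < r"
  using assms by (simp add: infdist_notempty cINF_less_iff)

text \<open>This replaces weak compactness of bounded closed convex sets. The distances of the sets
  from the origin increase to a limit \<open>m\<close>, and cutting the sets with balls of radius slightly above
  \<open>m\<close> makes their diameters tend to \<open>0\<close>, so that completeness applies.\<close>

lemma nested_closed_convex_Inter_nonempty:
  fixes K :: "nat \<Rightarrow> 'a::{real_inner,complete_space} set"
  assumes clo: "\<And>n. closed (K n)" and cvx: "\<And>n. convex (K n)" and ne: "\<And>n. K n \<noteq> {}"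
    and dec: "\<And>m n. m \<le> n \<Longrightarrow> K n \<subseteq> K m" and bdd: "bounded (K 0)"
  obtains a where "\<And>n. a \<in> K n"
proof -
  define d where "d n = infdist 0 (K n)" for n
  obtain B where B: "\<And>z. z \<in> K 0 \<Longrightarrow> norm z \<le> B"
    using bdd by (auto simp: bounded_iff)
  have dB: "d n \<le> B" for n
  proof -
    obtain z where "z \<in> K n" using ne by blast
    then show ?thesis
      unfolding d_def using B[of z] dec[of 0 n] infdist_le2[of z "K n" 0 B] by auto
  qed
  have "incseq d"
    unfolding d_def by (intro incseq_SucI infdist_mono dec ne) auto
  then obtain m where m: "d \<longlonglongrightarrow> m" "\<And>n. d n \<le> m"
    using incseq_convergent[of d B] dB by auto
  define r where "r n = m + inverse (real (Suc n))" for n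
  define S where "S n = K n \<inter> cball 0 (r n)" for n
  have "(\<lambda>n. 4 * ((r n)\<^sup>2 - (d n)\<^sup>2)) \<longlonglongrightarrow> 4 * ((m + 0)\<^sup>2 - m\<^sup>2)"
    unfolding r_def by (intro tendsto_intros m LIMSEQ_inverse_real_of_nat)
  then have lim: "(\<lambda>n. 4 * ((r n)\<^sup>2 - (d n)\<^sup>2)) \<longlonglongrightarrow> 0"
    by simp
  show thesis
  proof (rule decreasing_closed_nest[of S])
    show "closed (S n)" for n
      unfolding S_def by (intro closed_Int clo closed_cball)
    show "S n \<noteq> {}" for n
    proof -
      have "infdist 0 (K n) < r n"
        using m(2)[of n] unfolding d_def r_def
        by (smt (verit) inverse_positive_iff_positive of_nat_0_less_iff zero_less_Suc)
      then obtain z where "z \<in> K n" "dist 0 z < r n"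
        using infdist_less_imp_ex[OF ne] by blast
      then show ?thesis
        unfolding S_def by auto
    qed
    show "S n \<subseteq> S m" if "m \<le> n" for m n
    proof -
      have "r n \<le> r m"
        unfolding r_def using that by (simp add: field_simps)
      then show ?thesis
        unfolding S_def using dec[OF that] by auto
    qed
    show "\<exists>n. \<forall>p\<in>S n. \<forall>q\<in>S n. dist p q < \<epsilon>" if "\<epsilon> > 0" for \<epsilon>
    proof -
      have "eventually (\<lambda>n. 4 * ((r n)\<^sup>2 - (d n)\<^sup>2) < \<epsilon>\<^sup>2) sequentially"
        using lim that by (intro order_tendstoD(2)[OF lim]) auto
      then obtain n where n: "4 * ((r n)\<^sup>2 - (d n)\<^sup>2) < \<epsilon>\<^sup>2"
        by (auto simp: eventually_sequentially)
      have "dist p q < \<epsilon>" if "p \<in> S n" "q \<in> S n" for p q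
      proof -
        have "(dist p q)\<^sup>2 < \<epsilon>\<^sup>2"
          using convex_shell_diameter[OF cvx, of p n q 0 "r n"] that n
          unfolding S_def d_def by auto
        then show ?thesis
          using \<open>\<epsilon> > 0\<close> by (simp add: power2_less_imp_less)
      qed
      then show ?thesis by blast
    qed
    fix a assume "\<And>n. a \<in> S n"
    then show thesis
      using that unfolding S_def by blast
  qed
qed

lemma nearest_point_exists:
  fixes C :: "'a::{real_inner,complete_space} set"
  assumes "C \<noteq> {}" "closed C" "convex C"
  obtains p where "p \<in> C" "\<And>z. z \<in> C \<Longrightarrow> dist x p \<le> dist x z"
proof -
  define r where "r n = infdist x C + inverse (real (Suc n))" for n
  obtain p where p: "\<And>n. p \<in> C \<inter> cball x (r n)"
  proof (rule nested_closed_convex_Inter_nonempty[of "\<lambda>n. C \<inter> cball x (r n)"])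
    show "C \<inter> cball x (r n) \<noteq> {}" for n
    proof -
      have "infdist x C < r n"
        unfolding r_def by simp
      then obtain z where "z \<in> C" "dist x z < r n"
        using infdist_less_imp_ex[OF assms(1)] by blast
      then show ?thesis by auto
    qed
    show "C \<inter> cball x (r n) \<subseteq> C \<inter> cball x (r m)" if "m \<le> n" for m n
    proof -
      have "r n \<le> r m"
        unfolding r_def using that by (simp add: field_simps)
      then show ?thesis by auto
    qed
  qed (use assms in \<open>auto intro: closed_Int convex_Int bounded_Int\<close>)
  have "r \<longlonglongrightarrow> infdist x C + 0"
    unfolding r_def by (intro tendsto_intros LIMSEQ_inverse_real_of_nat)
  then have "dist x p \<le> infdist x C + 0"
    by (rule LIMSEQ_le_const) (use p in auto)
  then show thesis
    using p that infdist_le[of _ C x] by (metis IntD1 add.right_neutral order_trans)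
qed

lemma metric_projection_in_and_nearest:
  fixes C :: "'a::{real_inner,complete_space} set"
  assumes "C \<noteq> {}" "closed C" "convex C"
  shows "metric_projection C x \<in> C \<and> (\<forall>z\<in>C. dist x (metric_projection C x) \<le> dist x z)"
proof -
  obtain p where p: "p \<in> C" "\<forall>z\<in>C. dist x p \<le> dist x z"
    using nearest_point_exists[OF assms] by metis
  show ?thesis
    unfolding metric_projection_def
  proof (rule theI)
    show "p \<in> C \<and> (\<forall>z\<in>C. dist x p \<le> dist x z)"
      using p by blast
    show "q = p" if "q \<in> C \<and> (\<forall>z\<in>C. dist x q \<le> dist x z)" for q
      using any_closest_point_unique[OF assms(3,2)] p that by blast
  qed
qed

lemma metric_projection_in:
  fixes C :: "'a::{real_inner,complete_space} set"
  assumes "C \<noteq> {}" "closed C" "convex C"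
  shows "metric_projection C x \<in> C"
  using metric_projection_in_and_nearest[OF assms] by blast

lemma metric_projection_obtuse:
  fixes C :: "'a::{real_inner,complete_space} set"
  assumes "C \<noteq> {}" "closed C" "convex C" "u \<in> C"
  shows "(x - metric_projection C x) \<bullet> (u - metric_projection C x) \<le> 0"
  using any_closest_point_dot[OF assms(3,2) _ assms(4)]
    metric_projection_in_and_nearest[OF assms(1-3)] by blast

section \<open>Tail hulls and weak convergence\<close>

definition tail_hull :: "(nat \<Rightarrow> 'a::real_normed_vector) \<Rightarrow> 'a set" where
  "tail_hull X = (\<Inter>n. closure (convex hull (X ` {n..})))"

lemma tail_hull_nonempty:
  fixes X :: "nat \<Rightarrow> 'a::{real_inner,complete_space}"
  assumes "bounded (range X)"
  shows "tail_hull X \<noteq> {}"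
proof -
  obtain a where "\<And>n. a \<in> closure (convex hull (X ` {n..}))"
  proof (rule nested_closed_convex_Inter_nonempty[of "\<lambda>n. closure (convex hull (X ` {n..}))"])
    show "closure (convex hull (X ` {n..})) \<subseteq> closure (convex hull (X ` {m..}))"
      if "m \<le> n" for m n
      using that by (intro closure_mono hull_mono image_mono) auto
    show "bounded (closure (convex hull (X ` {0..})))"
      using assms by (intro bounded_closure bounded_convex_hull) (simp add: atLeast_0)
  qed (auto intro: convex_closure convex_convex_hull)
  then show ?thesis
    unfolding tail_hull_def by blast
qed

lemma tail_hull_subseq:
  assumes "strict_mono r"
  shows "tail_hull (X \<circ> r) \<subseteq> tail_hull X"
proof -
  have "(X \<circ> r) ` {n..} \<subseteq> X ` {n..}" for n
  proof
    fix v assume "v \<in> (X \<circ> r) ` {n..}"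
    then obtain k where "k \<ge> n" "v = X (r k)" by auto
    moreover have "k \<le> r k"
      using assms by (rule strict_mono_imp_increasing)
    ultimately show "v \<in> X ` {n..}" by auto
  qed
  then show ?thesis
    unfolding tail_hull_def by (intro INF_mono' closure_mono hull_mono)
qed

text \<open>Each tail eventually lies in the closed half-space \<open>{v. f v \<le> c + \<epsilon>}\<close>, hence so does
  its closed convex hull.\<close>

lemma tail_hull_upper_bound:
  fixes f :: "'a::real_normed_vector \<Rightarrow> real"
  assumes f: "bounded_linear f" and z: "z \<in> tail_hull X"
    and le: "\<And>k. f (X k) \<le> c + e k" and e: "e \<longlonglongrightarrow> 0"
  shows "f z \<le> c"
proof (rule field_le_epsilon)
  fix \<epsilon> :: real assume "\<epsilon> > 0"
  then obtain n where n: "\<And>k. k \<ge> n \<Longrightarrow> e k < \<epsilon>"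
    using order_tendstoD(2)[OF e] by (auto simp: eventually_sequentially)
  let ?H = "{v. f v \<le> c + \<epsilon>}"
  interpret bounded_linear f by (rule f)
  have "closed ?H"
    by (intro closed_Collect_le continuous_on continuous_on_const continuous_on_id)
  moreover have "convex ?H"
  proof (rule convexI)
    fix p q u v assume *: "p \<in> ?H" "q \<in> ?H" "0 \<le> u" "0 \<le> v" "u + v = (1::real)"
    have "u * f p + v * f q \<le> c + \<epsilon>"
      using * by (intro convex_bound_le) auto
    then show "u *\<^sub>R p + v *\<^sub>R q \<in> ?H"
      by (simp add: add scaleR)
  qed
  moreover have "X ` {n..} \<subseteq> ?H"
    using le n by (fastforce intro: order_trans)
  ultimately have "closure (convex hull (X ` {n..})) \<subseteq> ?H"
    by (intro closure_minimal hull_minimal)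
  then show "f z \<le> c + \<epsilon>"
    using z unfolding tail_hull_def by blast
qed

lemma tail_hull_limit:
  fixes f :: "'a::real_normed_vector \<Rightarrow> real"
  assumes f: "bounded_linear f" and z: "z \<in> tail_hull X" and lim: "(\<lambda>k. f (X k)) \<longlonglongrightarrow> l"
  shows "f z = l"
proof (rule antisym)
  show "f z \<le> l"
    by (rule tail_hull_upper_bound[OF f z, of _ "\<lambda>k. f (X k) - l"])
      (use lim in \<open>auto simp: LIM_zero_iff\<close>)
  have "- f z \<le> - l"
    by (rule tail_hull_upper_bound[OF bounded_linear_minus[OF f] z, of _ "\<lambda>k. l - f (X k)"])
      (use tendsto_diff[OF tendsto_const lim, of l] in auto)
  then show "l \<le> f z" by simp
qed

text \<open>Fix \<open>s\<close> in the tail hull. If \<open>f (X k)\<close> did not tend to \<open>f s\<close>, some subsequence would keep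
  \<open>f\<close> away from \<open>f s\<close>, and so would any point \<open>t\<close> of the tail hull of that subsequence. But by
  polarization the convergence of the two norms makes \<open>\<langle>X k, t - s\<rangle>\<close> converge. The
  continuous functional \<open>\<langle>_, t - s\<rangle>\<close> then takes the same value at \<open>s\<close> and at \<open>t\<close>, that is, \<open>s = t\<close>.\<close>

lemma opial_tail_hull:
  fixes X :: "nat \<Rightarrow> 'a::{real_inner,complete_space}"
  assumes conv: "\<And>s. s \<in> S \<Longrightarrow> convergent (\<lambda>k. norm (X k - s))"
    and sub: "tail_hull X \<subseteq> S" and bdd: "bounded (range X)"
  shows "\<exists>s\<in>S. weakly_converges_to X s"
proof -
  obtain s where s: "s \<in> tail_hull X"
    using tail_hull_nonempty[OF bdd] by blast
  have unique: "t = s" if r: "strict_mono r" and t: "t \<in> tail_hull (X \<circ> r)" for r t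
  proof -
    have "t \<in> S" "s \<in> S"
      using t s tail_hull_subseq[OF r] sub by blast+
    then obtain a b where ab: "(\<lambda>k. norm (X k - s)) \<longlonglongrightarrow> a" "(\<lambda>k. norm (X k - t)) \<longlonglongrightarrow> b"
      using conv unfolding convergent_def by blast
    have polar: "X k \<bullet> (t - s)
        = ((norm (X k - s))\<^sup>2 - (norm (X k - t))\<^sup>2 + (norm t)\<^sup>2 - (norm s)\<^sup>2) / 2" for k
      unfolding power2_norm_eq_inner
      by (simp add: inner_diff_left inner_diff_right inner_commute field_simps)
    have lim: "(\<lambda>k. X k \<bullet> (t - s)) \<longlonglongrightarrow> (a\<^sup>2 - b\<^sup>2 + (norm t)\<^sup>2 - (norm s)\<^sup>2) / 2"
      unfolding polar by (intro tendsto_intros ab) simp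
    have lin: "bounded_linear (\<lambda>v. v \<bullet> (t - s))"
      by (rule bounded_linear_inner_left)
    have "s \<bullet> (t - s) = t \<bullet> (t - s)"
      using tail_hull_limit[OF lin s lim] tail_hull_limit[OF lin t]
        LIMSEQ_subseq_LIMSEQ[OF lim r] by (simp add: o_def)
    then have "(t - s) \<bullet> (t - s) = 0"
      by (simp add: inner_diff_left)
    then show ?thesis by simp
  qed
  have half: "eventually (\<lambda>k. f (X k) < c) sequentially"
    if f: "bounded_linear f" and c: "f s < c" for f :: "'a \<Rightarrow> real" and c
  proof (rule ccontr)
    assume "\<not> eventually (\<lambda>k. f (X k) < c) sequentially"
    then have "frequently (\<lambda>k. c \<le> f (X k)) sequentially"
      by (simp add: not_eventually not_less)
    then have "\<forall>n. \<exists>k\<ge>n. c \<le> f (X k)"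
      by (simp add: frequently_sequentially)
    then have "infinite {k. c \<le> f (X k)}"
      unfolding infinite_nat_iff_unbounded_le by simp
    then obtain r :: "nat \<Rightarrow> nat" where r: "strict_mono r" "\<And>n. c \<le> f (X (r n))"
      using infinite_enumerate[of "{k. c \<le> f (X k)}"] by auto
    have "bounded (range (X \<circ> r))"
      using bdd by (rule bounded_subset) auto
    then obtain t where t: "t \<in> tail_hull (X \<circ> r)"
      using tail_hull_nonempty by blast
    have "- f t \<le> - c"
      by (rule tail_hull_upper_bound[OF bounded_linear_minus[OF f] t, of _ "\<lambda>_. 0"])
        (use r in auto)
    then show False
      using unique[OF r(1) t] c by simp
  qed
  have "(\<lambda>k. f (X k)) \<longlonglongrightarrow> f s" if f: "bounded_linear f" for f :: "'a \<Rightarrow> real"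
  proof (rule order_tendstoI)
    show "eventually (\<lambda>k. f (X k) < c) sequentially" if "f s < c" for c
      using half[OF f that] .
    show "eventually (\<lambda>k. c < f (X k)) sequentially" if "c < f s" for c
      using half[OF bounded_linear_minus[OF f], of "- c"] that by simp
  qed
  then have "weakly_converges_to X s"
    unfolding weakly_converges_to_def by blast
  then show ?thesis
    using s sub by blast
qed

section \<open>Monotone variational inequalities\<close>

text \<open>Test the hypothesis at \<open>z + t (u - z)\<close>, divide by \<open>t\<close>, and let \<open>t\<close> tend to \<open>0\<close>.\<close>

lemma minty_imp_SOL:
  fixes C :: "'a::real_inner set"
  assumes "convex C" "z \<in> C" "continuous_on UNIV F"
    and minty: "\<And>u. u \<in> C \<Longrightarrow> F u \<bullet> (u - z) \<ge> 0"
  shows "z \<in> SOL C F"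
proof -
  have "F z \<bullet> (u - z) \<ge> 0" if "u \<in> C" for u
  proof -
    define t where "t n = inverse (real (Suc n))" for n
    define v where "v n = z + t n *\<^sub>R (u - z)" for n
    have t: "0 < t n" "t n \<le> 1" for n
      unfolding t_def by (auto simp: field_simps)
    have pos: "F (v n) \<bullet> (u - z) \<ge> 0" for n
    proof -
      have "v n = (1 - t n) *\<^sub>R z + t n *\<^sub>R u"
        unfolding v_def by (simp add: algebra_simps)
      then have "v n \<in> C"
        using convexD_alt[OF assms(1,2) that, of "t n"] t[of n] by simp
      then have "0 \<le> F (v n) \<bullet> (v n - z)"
        by (rule minty)
      also have "\<dots> = t n * (F (v n) \<bullet> (u - z))"
        unfolding v_def by simp
      finally show ?thesis
        using t[of n] by (simp add: zero_le_mult_iff)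
    qed
    have "v \<longlonglongrightarrow> z + 0 *\<^sub>R (u - z)"
      unfolding v_def t_def by (intro tendsto_intros LIMSEQ_inverse_real_of_nat)
    then have "(\<lambda>n. F (v n)) \<longlonglongrightarrow> F z"
      using assms(3) by (intro continuous_on_tendsto_compose[OF assms(3)]) auto
    then have "(\<lambda>n. F (v n) \<bullet> (u - z)) \<longlonglongrightarrow> F z \<bullet> (u - z)"
      by (intro tendsto_intros)
    then show ?thesis
      by (rule LIMSEQ_le_const) (use pos in auto)
  qed
  then show ?thesis
    unfolding SOL_def using assms(2) by blast
qed

text \<open>If \<open>p\<close> is the projection of \<open>z\<close> onto \<open>C\<close>, the functional \<open>\<langle>z - p, _\<rangle>\<close> is at most
  \<open>\<langle>z - p, p\<rangle>\<close> on \<open>C\<close>, hence asymptotically along \<open>X\<close> and finally at \<open>z\<close> itself.\<close>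

lemma tail_hull_in_closed_convex:
  fixes C :: "'a::{real_inner,complete_space} set"
  assumes C: "C \<noteq> {}" "closed C" "convex C" and y: "\<And>k. y k \<in> C"
    and lim: "(\<lambda>k. norm (X k - y k)) \<longlonglongrightarrow> 0" and z: "z \<in> tail_hull X"
  shows "z \<in> C"
proof -
  define p where "p = metric_projection C z"
  have "(z - p) \<bullet> z \<le> (z - p) \<bullet> p"
  proof (rule tail_hull_upper_bound[OF bounded_linear_inner_right z])
    show "(z - p) \<bullet> X k \<le> (z - p) \<bullet> p + norm (z - p) * norm (X k - y k)" for k
    proof -
      have "(z - p) \<bullet> (y k - p) \<le> 0"
        unfolding p_def by (rule metric_projection_obtuse[OF C y])
      moreover have "(z - p) \<bullet> (X k - y k) \<le> norm (z - p) * norm (X k - y k)"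
        by (rule norm_cauchy_schwarz)
      ultimately show ?thesis
        by (simp add: inner_diff_right)
    qed
    show "(\<lambda>k. norm (z - p) * norm (X k - y k)) \<longlonglongrightarrow> 0"
      using tendsto_mult_left[OF lim, of "norm (z - p)"] by simp
  qed
  then have "(z - p) \<bullet> (z - p) \<le> 0"
    by (simp add: inner_diff_right)
  then have "(z - p) \<bullet> (z - p) = 0"
    by (intro antisym inner_ge_zero)
  then have "z = p"
    by simp
  then show ?thesis
    using metric_projection_in[OF C, of z] unfolding p_def by simp
qed

section \<open>One step of the method\<close>

text \<open>Add the projection inequality at \<open>s\<close> and \<open>\<beta> \<langle>F y, y - s\<rangle> \<ge> 0\<close>, which monotonicity
  derives from the variational inequality for \<open>s\<close>.\<close>

lemma pc_direction_separates:
  fixes C :: "'a::{real_inner,complete_space} set"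
  assumes C: "C \<noteq> {}" "closed C" "convex C" and mono: "monotone_operator F"
    and s: "s \<in> SOL C F" and b: "b > 0"
    and y: "y = metric_projection C (w - b *\<^sub>R F w)"
  shows "pc_direction F b w y \<bullet> (y - s) \<ge> 0"
proof -
  have sC: "s \<in> C" and yC: "y \<in> C"
    using s metric_projection_in[OF C] y unfolding SOL_def by auto
  have "(w - b *\<^sub>R F w - y) \<bullet> (s - y) \<le> 0"
    unfolding y by (rule metric_projection_obtuse[OF C sC])
  moreover have "F s \<bullet> (y - s) \<ge> 0"
    using s yC unfolding SOL_def by blast
  moreover have "(F y - F s) \<bullet> (y - s) \<ge> 0"
    using mono unfolding monotone_operator_def by blast
  ultimately have "(w - b *\<^sub>R F w - y) \<bullet> (y - s) \<ge> 0" "F y \<bullet> (y - s) \<ge> 0"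
    by (simp_all add: inner_diff_left inner_diff_right)
  then have "(w - b *\<^sub>R F w - y) \<bullet> (y - s) + b * (F y \<bullet> (y - s)) \<ge> 0"
    using b by simp
  moreover have "pc_direction F b w y = (w - b *\<^sub>R F w - y) + b *\<^sub>R F y"
    unfolding pc_direction_def by (simp add: algebra_simps)
  ultimately show ?thesis
    by (simp add: inner_add_left)
qed

text \<open>The step-size condition makes \<open>d\<close> a perturbation of \<open>w - y\<close> of relative size \<open>\<nu>\<close>, so
  \<open>\<rho> \<langle>w - y, d\<rangle> = \<langle>w - y, d\<rangle>\<^sup>2 / \<parallel>d\<parallel>\<^sup>2\<close> is at least \<open>((1 - \<nu>) / (1 + \<nu>))\<^sup>2 \<parallel>w - y\<parallel>\<^sup>2\<close>. The
  factor \<open>\<gamma> (2 - \<gamma>)\<close> comes from expanding \<open>\<parallel>w - \<gamma> \<rho> d - s\<parallel>\<^sup>2\<close>.\<close>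

lemma pc_step_decrease:
  fixes C :: "'a::{real_inner,complete_space} set"
  assumes C: "C \<noteq> {}" "closed C" "convex C" and mono: "monotone_operator F"
    and s: "s \<in> SOL C F" and b: "b > 0"
    and y: "y = metric_projection C (w - b *\<^sub>R F w)"
    and \<nu>: "0 < \<nu>" "\<nu> < 1" and \<gamma>: "0 < \<gamma>" "\<gamma> < 2"
    and step: "b * norm (F w - F y) \<le> \<nu> * norm (w - y)"
    and nz: "pc_direction F b w y \<noteq> 0"
  shows "(norm (w - (\<gamma> * pc_rho F b w y) *\<^sub>R pc_direction F b w y - s))\<^sup>2
    \<le> (norm (w - s))\<^sup>2 - \<gamma> * (2 - \<gamma>) * ((1 - \<nu>) / (1 + \<nu>))\<^sup>2 * (norm (w - y))\<^sup>2"
proof -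
  define d where "d = pc_direction F b w y"
  define e where "e = b *\<^sub>R (F w - F y)"
  define r where "r = pc_rho F b w y"
  define q where "q = (w - y) \<bullet> d"
  define n where "n = norm (w - y)"
  have d: "d = (w - y) - e"
    unfolding d_def e_def pc_direction_def by simp
  have e: "norm e \<le> \<nu> * n"
    unfolding e_def n_def using step b by simp
  have n0: "n \<ge> 0"
    unfolding n_def by simp
  have dpos: "norm d > 0"
    using nz unfolding d_def by simp
  have r: "r = q / (norm d)\<^sup>2"
    unfolding r_def q_def d_def pc_rho_def by simp
  have "(w - y) \<bullet> e \<le> n * norm e"
    unfolding n_def by (rule norm_cauchy_schwarz)
  also have "\<dots> \<le> n * (\<nu> * n)"
    using e n0 by (rule mult_left_mono)
  finally have we: "(w - y) \<bullet> e \<le> \<nu> * n\<^sup>2"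
    by (simp add: power2_eq_square mult.left_commute)
  have "q = n\<^sup>2 - (w - y) \<bullet> e"
    unfolding q_def d n_def by (simp only: inner_diff_right[of _ "w - y"] power2_norm_eq_inner)
  then have q: "(1 - \<nu>) * n\<^sup>2 \<le> q"
    using we by (simp add: left_diff_distrib)
  have dn: "norm d \<le> (1 + \<nu>) * n"
    using norm_triangle_ineq4[of "w - y" e] e unfolding d n_def by (simp add: algebra_simps)
  have q0: "0 \<le> q"
    using q \<nu> by (smt (verit) mult_nonneg_nonneg zero_le_power2)
  have gain: "((1 - \<nu>) / (1 + \<nu>))\<^sup>2 * n\<^sup>2 \<le> r * q"
  proof -
    have "((1 - \<nu>) * n\<^sup>2)\<^sup>2 * (norm d)\<^sup>2 \<le> q\<^sup>2 * ((1 + \<nu>) * n)\<^sup>2"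
      using q dn \<nu> by (intro mult_mono power_mono) auto
    moreover have "n > 0"
      using dn dpos \<nu> n0 by (cases "n = 0") auto
    moreover have "((1 - \<nu>) * n\<^sup>2)\<^sup>2 * (norm d)\<^sup>2 = n\<^sup>2 * (((1 - \<nu>) * n)\<^sup>2 * (norm d)\<^sup>2)"
      "q\<^sup>2 * ((1 + \<nu>) * n)\<^sup>2 = n\<^sup>2 * (q\<^sup>2 * (1 + \<nu>)\<^sup>2)"
      by (simp_all add: power2_eq_square mult_ac)
    ultimately have "((1 - \<nu>) * n)\<^sup>2 * (norm d)\<^sup>2 \<le> q\<^sup>2 * (1 + \<nu>)\<^sup>2"
      by simp
    then show ?thesis
      unfolding r using dpos \<nu>
      by (simp add: power_divide power_mult_distrib divide_simps power2_eq_square[of q])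
  qed
  have "d \<bullet> (y - s) \<ge> 0"
    unfolding d_def by (rule pc_direction_separates[OF C mono s b y])
  then have ws: "q \<le> d \<bullet> (w - s)"
    unfolding q_def by (simp add: inner_diff_right inner_diff_left inner_commute)
  have r0: "0 \<le> r"
    unfolding r using q0 by simp
  have rd: "r\<^sup>2 * (norm d)\<^sup>2 = r * q"
    unfolding r using dpos by (simp add: power2_eq_square)
  have "(norm (w - (\<gamma> * r) *\<^sub>R d - s))\<^sup>2
      = (norm (w - s))\<^sup>2 - 2 * (\<gamma> * r) * (d \<bullet> (w - s)) + \<gamma>\<^sup>2 * (r\<^sup>2 * (norm d)\<^sup>2)"
    unfolding power2_norm_eq_inner
    by (simp add: inner_diff_left inner_diff_right inner_commute algebra_simps power2_eq_square)
  also have "\<dots> \<le> (norm (w - s))\<^sup>2 - 2 * (\<gamma> * r) * q + \<gamma>\<^sup>2 * (r * q)"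
    unfolding rd using ws r0 \<gamma> by (simp add: mult_left_mono)
  also have "\<dots> = (norm (w - s))\<^sup>2 - \<gamma> * (2 - \<gamma>) * (r * q)"
    by (simp add: algebra_simps power2_eq_square)
  also have "\<dots> \<le> (norm (w - s))\<^sup>2 - \<gamma> * (2 - \<gamma>) * (((1 - \<nu>) / (1 + \<nu>))\<^sup>2 * n\<^sup>2)"
    using gain \<gamma> by (intro diff_left_mono mult_left_mono) auto
  finally show ?thesis
    unfolding r_def d_def n_def by (simp add: mult.assoc)
qed

text \<open>By monotonicity \<open>F u\<close> may replace \<open>F y\<close>, and Lipschitz continuity controls the
  difference between \<open>F w\<close> and \<open>F y\<close>. The lower bound on the step size keeps the division of the
  projection inequality by \<open>b\<close> harmless.\<close>

lemma pc_step_minty_residual: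
  fixes C :: "'a::{real_inner,complete_space} set"
  assumes C: "C \<noteq> {}" "closed C" "convex C" and mono: "monotone_operator F"
    and lip: "L-lipschitz_on UNIV F" and b: "0 < b0" "b0 \<le> b"
    and y: "y = metric_projection C (w - b *\<^sub>R F w)" and u: "u \<in> C"
  shows "F u \<bullet> (y - u) \<le> (1 / b0 + L) * norm (w - y) * norm (u - y)"
proof -
  have bpos: "b > 0" using b by simp
  have "(w - b *\<^sub>R F w - y) \<bullet> (u - y) \<le> 0"
    unfolding y by (rule metric_projection_obtuse[OF C u])
  then have "b * - (F w \<bullet> (u - y)) \<le> - ((w - y) \<bullet> (u - y))"
    by (simp add: inner_diff_left algebra_simps)
  also have "\<dots> \<le> norm (w - y) * norm (u - y)"
    using norm_cauchy_schwarz[of "y - w" "u - y"]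
    by (simp add: inner_diff_left norm_minus_commute)
  finally have "- (F w \<bullet> (u - y)) \<le> norm (w - y) * norm (u - y) / b"
    using bpos by (simp add: pos_le_divide_eq mult.commute)
  also have "\<dots> \<le> norm (w - y) * norm (u - y) / b0"
    using b by (intro divide_left_mono) auto
  finally have Fw: "- (F w \<bullet> (u - y)) \<le> 1 / b0 * norm (w - y) * norm (u - y)"
    by simp
  have "(F w - F y) \<bullet> (u - y) \<le> norm (F w - F y) * norm (u - y)"
    by (rule norm_cauchy_schwarz)
  also have "\<dots> \<le> L * norm (w - y) * norm (u - y)"
    using lipschitz_onD[OF lip, of w y] by (intro mult_right_mono) (auto simp: dist_norm)
  finally have Fwy: "(F w - F y) \<bullet> (u - y) \<le> L * norm (w - y) * norm (u - y)" .
  have "(F u - F y) \<bullet> (u - y) \<ge> 0"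
    using mono unfolding monotone_operator_def by blast
  then have "F u \<bullet> (y - u) \<le> - (F w \<bullet> (u - y)) + (F w - F y) \<bullet> (u - y)"
    by (simp add: inner_diff_left inner_diff_right)
  also have "\<dots> \<le> (1 / b0 + L) * norm (w - y) * norm (u - y)"
    using Fw Fwy by (simp add: algebra_simps)
  finally show ?thesis .
qed

section \<open>Convergence of the inertial iteration\<close>

text \<open>Subtracting the partial sums of \<open>\<delta>\<close> from \<open>a\<close> gives a decreasing sequence bounded below.\<close>

lemma convergent_of_summable_increase:
  fixes a \<delta> :: "nat \<Rightarrow> real"
  assumes a: "\<And>k. 0 \<le> a k" and step: "\<And>k. a (Suc k) \<le> a k + \<delta> k"
    and \<delta>: "\<And>k. 0 \<le> \<delta> k" "summable \<delta>"
  shows "convergent a"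
proof -
  define c where "c k = a k - sum \<delta> {..<k}" for k
  have "decseq c"
    unfolding c_def using step by (intro decseq_SucI) (simp add: algebra_simps)
  moreover have "- suminf \<delta> \<le> c k" for k
    unfolding c_def using a[of k] sum_le_suminf[OF \<delta>(2), of "{..<k}"] \<delta>(1) by auto
  ultimately obtain l where "c \<longlonglongrightarrow> l"
    using decseq_convergent by blast
  then have "(\<lambda>k. c k + sum \<delta> {..<k}) \<longlonglongrightarrow> l + suminf \<delta>"
    by (intro tendsto_add summable_LIMSEQ[OF \<delta>(2)])
  then show ?thesis
    unfolding c_def convergent_def by auto
qed

text \<open>If the distances from \<open>X k\<close> and from \<open>W k\<close> to a point have the same limit, the decrease
  from \<open>W k\<close> to \<open>X (k + 1)\<close> must vanish in the limit.\<close>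

lemma perturbed_decrease_limits:
  fixes X W Y :: "nat \<Rightarrow> 'a::real_inner"
  assumes dec: "\<And>k. (norm (X (Suc k) - s))\<^sup>2 \<le> (norm (W k - s))\<^sup>2 - c * (norm (W k - Y k))\<^sup>2"
    and c: "c > 0" and pert: "summable (\<lambda>k. norm (W k - X k))"
  shows "convergent (\<lambda>k. norm (X k - s))" and "(\<lambda>k. norm (W k - Y k)) \<longlonglongrightarrow> 0"
proof -
  define \<delta> where "\<delta> k = norm (W k - X k)" for k
  have tri: "\<bar>norm (W k - s) - norm (X k - s)\<bar> \<le> \<delta> k" for k
    using norm_triangle_ineq3[of "W k - s" "X k - s"] unfolding \<delta>_def by simp
  have "norm (X (Suc k) - s) \<le> norm (X k - s) + \<delta> k" for k
  proof -
    have "(norm (X (Suc k) - s))\<^sup>2 \<le> (norm (W k - s))\<^sup>2"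
      using dec[of k] c by (smt (verit) mult_nonneg_nonneg zero_le_power2)
    then have "norm (X (Suc k) - s) \<le> norm (W k - s)"
      by (rule power2_le_imp_le) simp
    then show ?thesis
      using tri[of k] by linarith
  qed
  then show conv: "convergent (\<lambda>k. norm (X k - s))"
    by (rule convergent_of_summable_increase[rotated]) (use pert in \<open>auto simp: \<delta>_def\<close>)
  then obtain l where l: "(\<lambda>k. norm (X k - s)) \<longlonglongrightarrow> l"
    unfolding convergent_def by blast
  have \<delta>0: "\<delta> \<longlonglongrightarrow> 0"
    using summable_LIMSEQ_zero[OF pert] unfolding \<delta>_def .
  have "(\<lambda>k. norm (W k - s) - norm (X k - s)) \<longlonglongrightarrow> 0"
    by (rule Lim_null_comparison[OF _ \<delta>0]) (use tri in auto)
  from tendsto_add[OF this l] have lW: "(\<lambda>k. norm (W k - s)) \<longlonglongrightarrow> l"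
    by simp
  have "(\<lambda>k. ((norm (W k - s))\<^sup>2 - (norm (X (Suc k) - s))\<^sup>2) / c) \<longlonglongrightarrow> (l\<^sup>2 - l\<^sup>2) / c"
    using c by (intro tendsto_intros lW LIMSEQ_Suc[OF l]) auto
  then have up: "(\<lambda>k. ((norm (W k - s))\<^sup>2 - (norm (X (Suc k) - s))\<^sup>2) / c) \<longlonglongrightarrow> 0"
    by simp
  have "(\<lambda>k. (norm (W k - Y k))\<^sup>2) \<longlonglongrightarrow> 0"
  proof (rule Lim_null_comparison[OF _ up], rule always_eventually, rule allI)
    show "norm ((norm (W k - Y k))\<^sup>2) \<le> ((norm (W k - s))\<^sup>2 - (norm (X (Suc k) - s))\<^sup>2) / c" for k
      using dec[of k] c by (simp add: pos_le_divide_eq algebra_simps)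
  qed
  from tendsto_real_sqrt[OF this] show "(\<lambda>k. norm (W k - Y k)) \<longlonglongrightarrow> 0"
    by simp
qed

theorem theorem5p4:
  fixes C :: "'a::{real_inner,complete_space} set"
    and F :: "'a \<Rightarrow> 'a"
    and L \<nu> \<gamma> \<beta>\<^sub>0 :: real
    and \<alpha> \<beta> :: "nat \<Rightarrow> real"
    and x :: "int \<Rightarrow> 'a"
    and w y :: "nat \<Rightarrow> 'a"
  assumes "C \<noteq> {}" and "closed C" and "convex C"
    and "SOL C F \<noteq> {}"
    and "monotone_operator F"
    and "L > 0" and "L-lipschitz_on UNIV F"
    and "0 < \<nu>" and "\<nu> < 1" and "0 < \<gamma>" and "\<gamma> < 2"
    and "\<forall>k. 0 \<le> \<alpha> k \<and> \<alpha> k \<le> 1"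
    and "generated_by_iPC_I2 C F \<nu> \<gamma> \<alpha> \<beta> x w y"
    and beta_bounded_below: "\<beta>\<^sub>0 > 0" "\<forall>k. \<beta>\<^sub>0 \<le> \<beta> k"
    and "summable (\<lambda>k. \<alpha> k * norm (x (int k) - x (int k - 1)))"
  shows "\<exists>s \<in> SOL C F. weakly_converges_to (\<lambda>k. x (int k)) s"
proof -
  note C = assms(1-3) and mono = assms(5) and lip = assms(7)
  define X where "X k = x (int k)" for k
  define c where "c = \<gamma> * (2 - \<gamma>) * ((1 - \<nu>) / (1 + \<nu>))\<^sup>2"
  have c: "c > 0"
    unfolding c_def using assms(8-11) by simp
  have w: "w k = X k + \<alpha> k *\<^sub>R (x (int k) - x (int k - 1))"
    and y: "y k = metric_projection C (w k - \<beta> k *\<^sub>R F (w k))"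
    and \<beta>: "\<beta> k > 0"
    and step: "\<beta> k * norm (F (w k) - F (y k)) \<le> \<nu> * norm (w k - y k)"
    and nz: "pc_direction F (\<beta> k) (w k) (y k) \<noteq> 0"
    and X_Suc: "X (Suc k) =
      w k - (\<gamma> * pc_rho F (\<beta> k) (w k) (y k)) *\<^sub>R pc_direction F (\<beta> k) (w k) (y k)" for k
    using assms(13)[unfolded generated_by_iPC_I2_def, THEN spec, of k]
    unfolding X_def of_nat_Suc add.commute[of 1 "int k"] by blast+
  have yC: "y k \<in> C" for k
    unfolding y by (rule metric_projection_in[OF C])

  have dec: "(norm (X (Suc k) - s))\<^sup>2 \<le> (norm (w k - s))\<^sup>2 - c * (norm (w k - y k))\<^sup>2"
    if "s \<in> SOL C F" for s k
    unfolding X_Suc c_def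
    by (rule pc_step_decrease[OF C mono that \<beta> y assms(8-11) step nz])
  have pert: "summable (\<lambda>k. norm (w k - X k))"
    using assms(16) assms(12) by (simp add: w)
  have conv: "convergent (\<lambda>k. norm (X k - s))" if "s \<in> SOL C F" for s
    using perturbed_decrease_limits(1)[of X s, OF dec[OF that] c pert] .
  obtain s0 where s0: "s0 \<in> SOL C F"
    using assms(4) by blast
  have wy: "(\<lambda>k. norm (w k - y k)) \<longlonglongrightarrow> 0"
    using perturbed_decrease_limits(2)[of X s0, OF dec[OF s0] c pert] .
  have Xy: "(\<lambda>k. norm (X k - y k)) \<longlonglongrightarrow> 0"
  proof (rule Lim_null_comparison)
    show "(\<lambda>k. norm (w k - X k) + norm (w k - y k)) \<longlonglongrightarrow> 0"
      using tendsto_add[OF summable_LIMSEQ_zero[OF pert] wy] by simp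
    show "eventually (\<lambda>k. norm (norm (X k - y k)) \<le> norm (w k - X k) + norm (w k - y k))
        sequentially"
    proof (rule always_eventually, rule allI)
      show "norm (norm (X k - y k)) \<le> norm (w k - X k) + norm (w k - y k)" for k
        using norm_triangle_ineq4[of "w k - y k" "w k - X k"] by simp
    qed
  qed

  have "Bseq (\<lambda>k. norm (X k - s0))"
    using conv[OF s0] by (rule convergent_imp_Bseq)
  then obtain B where B: "\<And>k. norm (X k - s0) \<le> B"
    by (auto simp: Bseq_def)
  have "norm (X k) \<le> B + norm s0" for k
    using B[of k] norm_triangle_ineq2[of "X k" s0] by linarith
  then have bdd: "bounded (range X)"
    by (auto simp: bounded_iff)

  have "tail_hull X \<subseteq> SOL C F"
  proof
    fix z assume z: "z \<in> tail_hull X"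
    show "z \<in> SOL C F"
    proof (rule minty_imp_SOL[OF assms(3)])
      show "z \<in> C"
        by (rule tail_hull_in_closed_convex[OF C yC Xy z])
      show "continuous_on UNIV F"
        using lip by (rule lipschitz_on_continuous_on)
      fix u assume u: "u \<in> C"
      \<comment> \<open>The last factor of the first summand bounds \<open>\<parallel>u - y k\<parallel>\<close>; the second
        summand pays for testing \<open>X k\<close> in place of \<open>y k\<close>.\<close>
      define e where "e k = (1 / \<beta>\<^sub>0 + L) * norm (w k - y k) * (norm (u - s0) + B + norm (X k - y k))
          + norm (F u) * norm (X k - y k)" for k
      have "F u \<bullet> X k \<le> F u \<bullet> u + e k" for k
      proof -
        have "F u \<bullet> (y k - u) \<le> (1 / \<beta>\<^sub>0 + L) * norm (w k - y k) * norm (u - y k)"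
          using beta_bounded_below by (intro pc_step_minty_residual[OF C mono lip _ _ y u]) auto
        also have "\<dots> \<le> (1 / \<beta>\<^sub>0 + L) * norm (w k - y k)
            * (norm (u - s0) + B + norm (X k - y k))"
        proof (rule mult_left_mono)
          have "norm (u - y k) \<le> norm (u - s0) + norm (s0 - X k) + norm (X k - y k)"
            using norm_triangle_ineq[of "u - s0" "s0 - X k"]
              norm_triangle_ineq[of "u - X k" "X k - y k"] by simp
          then show "norm (u - y k) \<le> norm (u - s0) + B + norm (X k - y k)"
            using B[of k] by (simp add: norm_minus_commute)
          show "0 \<le> (1 / \<beta>\<^sub>0 + L) * norm (w k - y k)"
            using beta_bounded_below assms(6) by simp
        qed
        finally show ?thesis
          using norm_cauchy_schwarz[of "F u" "X k - y k"] unfolding e_def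
          by (simp add: inner_diff_right)
      qed
      moreover have "e \<longlonglongrightarrow> (1 / \<beta>\<^sub>0 + L) * 0 * (norm (u - s0) + B + 0) + norm (F u) * 0"
        unfolding e_def by (intro tendsto_add tendsto_mult tendsto_const wy Xy)
      ultimately have "F u \<bullet> z \<le> F u \<bullet> u"
        by (intro tail_hull_upper_bound[OF bounded_linear_inner_right z, of _ _ e]) auto
      then show "F u \<bullet> (u - z) \<ge> 0"
        by (simp add: inner_diff_right)
    qed
  qed
  from opial_tail_hull[OF conv this bdd] show ?thesis
    unfolding X_def .
qed

end
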